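(* Let $X$ be a compact metric space and $T:X\to X$ a surjective local homeomorphism such that $Sp_l(X,T)$ is finite and consists of isolated points of $X$. Then \[{\rm dad}(\mathcal{G}_{(X,T)})\le 2\,{\rm dim}_{\rm Rok}(X,T)+1.\]
   Context: $Sp_l(X,T)=\{x:|T^{-1}(\{x\})|\ge2\}$. $\mathcal{G}_{(X,T)}=\{(x,m-n,y): T^m(x)=T^n(y), m,n\in\mathbb{N}\}$ is the Deaconu–Renault groupoid (unit space $X$, $r(x,k,y)=x$, $s(x,k,y)=y$, standard étale topology). ${\rm dad}(\mathcal{G})$: least $d$ such that for every open relatively compact $K\subseteq\mathcal{G}$ there are open $U_0,\dots,U_d\subseteq\mathcal{G}^{(0)}$ covering $s(K)\cup r(K)$ with each $\{g\in K:s(g),r(g)\in U_i\}$ contained in a relatively compact subgroupoid. ${\rm dim}_{\rm Rok}(X,T)$: least $d$ such that for every $N\ge1$, $X$ is covered by the members of at most $d+1$ open $N$-Rokhlin towers, where an open $N$-Rokhlin tower is $\{U_0,\dots,U_{N-1}\}$ of nonempty open sets with $U_k=T^{-1}(U_{k-1})$ and pairwise disjoint closures. *)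

theory Defs
  imports "HOL-Analysis.Analysis"
begin

text \<open>Dynamical setting: the compact metric space X is the whole type 'a.\<close>

definition local_homeo :: "('a::topological_space \<Rightarrow> 'b::topological_space) \<Rightarrow> bool" where
  "local_homeo T \<longleftrightarrow> continuous_on UNIV T \<and>
     (\<forall>x. \<exists>U. open U \<and> x \<in> U \<and> open (T ` U) \<and> (\<exists>g. homeomorphism U (T ` U) T g))"

definition Sp_l :: "('a \<Rightarrow> 'a) \<Rightarrow> 'a set" where
  "Sp_l T = {x. \<exists>a b. a \<noteq> b \<and> T a = x \<and> T b = x}"

definition DR_groupoid :: "('a \<Rightarrow> 'a) \<Rightarrow> ('a \<times> int \<times> 'a) set" where
  "DR_groupoid T = {(x, k, y) | x k y. \<exists>m n::nat. k = int m - int n \<and> (T ^^ m) x = (T ^^ n) y}"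

definition DR_r :: "'a \<times> int \<times> 'a \<Rightarrow> 'a" where "DR_r g = fst g"
definition DR_s :: "'a \<times> int \<times> 'a \<Rightarrow> 'a" where "DR_s g = snd (snd g)"

definition DR_Z :: "('a \<Rightarrow> 'a) \<Rightarrow> 'a set \<Rightarrow> nat \<Rightarrow> nat \<Rightarrow> 'a set \<Rightarrow> ('a \<times> int \<times> 'a) set" where
  "DR_Z T U m n V = {(x, int m - int n, y) | x y. x \<in> U \<and> y \<in> V \<and> (T ^^ m) x = (T ^^ n) y}"

definition DR_top :: "('a::topological_space \<Rightarrow> 'a) \<Rightarrow> ('a \<times> int \<times> 'a) topology" where
  "DR_top T = topology_generated_by {DR_Z T U m n V | U m n V. open U \<and> open V}"

definition DR_subgroupoid :: "('a \<Rightarrow> 'a) \<Rightarrow> ('a \<times> int \<times> 'a) set \<Rightarrow> bool" where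
  "DR_subgroupoid T H \<longleftrightarrow> H \<subseteq> DR_groupoid T \<and>
     (\<forall>x k y. (x, k, y) \<in> H \<longrightarrow> (y, -k, x) \<in> H) \<and>
     (\<forall>x k y l z. (x, k, y) \<in> H \<and> (y, l, z) \<in> H \<longrightarrow> (x, k + l, z) \<in> H)"

definition rel_compact_in :: "'b topology \<Rightarrow> 'b set \<Rightarrow> bool" where
  "rel_compact_in \<tau> K \<longleftrightarrow> K \<subseteq> topspace \<tau> \<and> compactin \<tau> (\<tau> closure_of K)"

text \<open>Dynamic asymptotic dimension at most d (unit space identified with X).\<close>
definition DR_dad_le :: "('a::topological_space \<Rightarrow> 'a) \<Rightarrow> nat \<Rightarrow> bool" where
  "DR_dad_le T d \<longleftrightarrow>
    (\<forall>K. openin (DR_top T) K \<and> rel_compact_in (DR_top T) K \<longrightarrow>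
      (\<exists>U :: nat \<Rightarrow> 'a set. (\<forall>i\<le>d. open (U i)) \<and>
         DR_s ` K \<union> DR_r ` K \<subseteq> (\<Union>i\<le>d. U i) \<and>
         (\<forall>i\<le>d. \<exists>H. DR_subgroupoid T H \<and> rel_compact_in (DR_top T) H \<and>
              {g \<in> K. DR_s g \<in> U i \<and> DR_r g \<in> U i} \<subseteq> H)))"

definition DR_dad :: "('a::topological_space \<Rightarrow> 'a) \<Rightarrow> enat" where
  "DR_dad T = (INF d \<in> {d. DR_dad_le T d}. enat d)"

definition rokhlin_tower :: "('a::topological_space \<Rightarrow> 'a) \<Rightarrow> nat \<Rightarrow> (nat \<Rightarrow> 'a set) \<Rightarrow> bool" where
  "rokhlin_tower T N U \<longleftrightarrow>
     (\<forall>k<N. open (U k) \<and> U k \<noteq> {}) \<and>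
     (\<forall>k. 0 < k \<and> k < N \<longrightarrow> U k = T -` U (k - 1)) \<and>
     (\<forall>j<N. \<forall>k<N. j \<noteq> k \<longrightarrow> closure (U j) \<inter> closure (U k) = {})"

definition rok_dim_le :: "('a::topological_space \<Rightarrow> 'a) \<Rightarrow> nat \<Rightarrow> bool" where
  "rok_dim_le T d \<longleftrightarrow>
    (\<forall>N\<ge>1. \<exists>\<T> :: (nat \<Rightarrow> 'a set) set. finite \<T> \<and> card \<T> \<le> d + 1 \<and>
        (\<forall>U\<in>\<T>. rokhlin_tower T N U) \<and> UNIV \<subseteq> (\<Union>U\<in>\<T>. \<Union>k<N. U k))"

definition rok_dim :: "('a::topological_space \<Rightarrow> 'a) \<Rightarrow> enat" where
  "rok_dim T = (INF d \<in> {d. rok_dim_le T d}. enat d)"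

end

theory Submission
  imports Defs
begin

text \<open>
  The sets \<open>{(x, k - l, y). T\<^sup>k x = T\<^sup>l y}\<close> are clopen and compact, so a subset of the groupoid is
  relatively compact as soon as it is covered by finitely many of them; in particular an open
  relatively compact \<open>K\<close> only involves exponents \<open>m, n \<le> M\<close> for some \<open>M\<close>. Take towers of height
  \<open>2 M\<close> and cut each one into its lower and its upper half, which gives \<open>2 (d + 1)\<close> open sets.

  Two points on levels \<open>k\<close>, \<open>l\<close> of one tower are related in the tower groupoid if
  \<open>T\<^sup>k x = T\<^sup>l y\<close>. From the upper half, \<open>M\<close> forward steps do not leave the tower, so the
  restriction of \<open>K\<close> lies in the tower groupoid. In the lower half, an arrow \<open>T\<^sup>m x = T\<^sup>n y\<close> with
  \<open>m \<ge> n\<close> is again in the tower groupoid if \<open>T\<^bsup>m-n\<^esup> x = y\<close>; otherwise the two forward orbits merge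
  at a point of \<open>Sp_l T\<close>, so that \<open>x\<close> and \<open>y\<close> belong to a finite set depending only on \<open>M\<close>.
  Finite Rokhlin dimension excludes periodic points, hence the groupoid restricted to a finite set
  is finite, and saturating that finite set under the tower groupoid leaves it finite.
\<close>

section \<open>Iterates of a local homeomorphism\<close>

lemma continuous_on_funpow:
  fixes T :: "'a::topological_space \<Rightarrow> 'a"
  assumes "continuous_on UNIV T"
  shows "continuous_on UNIV (T ^^ n)"
proof (induction n)
  case 0
  then show ?case by (simp add: id_def)
next
  case (Suc n)
  then show ?case
    using continuous_on_compose[OF Suc continuous_on_subset[OF assms]] by simp
qed

lemma open_vimage_funpow:
  fixes T :: "'a::topological_space \<Rightarrow> 'a"
  assumes "continuous_on UNIV T" "open U"
  shows "open ((T ^^ n) -` U)"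
  using open_vimage[OF assms(2) continuous_on_funpow[OF assms(1)]] .

lemma funpow_add_apply: "(f ^^ (m + n)) x = (f ^^ m) ((f ^^ n) x)"
  by (simp add: funpow_add)

text \<open>Induction on \<open>n\<close>: intersect a neighbourhood that works for
  \<open>T ^^ n\<close> with the pullback of one around \<open>(T ^^ n) x\<close> on which
  \<open>T\<close> is injective. Local injectivity yields both the finite fibres and the compactness
  of the pieces \<open>DR_Z T UNIV k l UNIV\<close>.\<close>

lemma local_homeo_funpow_locally_inj:
  fixes T :: "'a::topological_space \<Rightarrow> 'a"
  assumes "local_homeo T"
  shows "\<exists>W. open W \<and> x \<in> W \<and> inj_on (T ^^ n) W"
proof (induction n)
  case 0
  show ?case by (rule exI[of _ UNIV]) simp
next
  case (Suc n)
  then obtain W where W: "open W" "x \<in> W" "inj_on (T ^^ n) W" by blast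
  obtain U g where U: "open U" "(T ^^ n) x \<in> U" "homeomorphism U (T ` U) T g"
    using assms unfolding local_homeo_def by blast
  have T: "inj_on T U"
    using U(3) by (metis homeomorphism_apply1 inj_onI)
  have "continuous_on UNIV T" using assms by (simp add: local_homeo_def)
  then have "open (W \<inter> (T ^^ n) -` U)"
    using W(1) U(1) by (intro open_Int open_vimage_funpow)
  moreover have "inj_on (T ^^ Suc n) (W \<inter> (T ^^ n) -` U)"
    using W(3) T by (auto simp: inj_on_def)
  ultimately show ?case using W(2) U(2) by blast
qed

text \<open>By compactness finitely many open sets on which \<open>T ^^ n\<close> is injective cover
  the space, and each contains at most one preimage of every point of \<open>S\<close>.\<close>

lemma local_homeo_finite_vimage_funpow:
  fixes T :: "'a::topological_space \<Rightarrow> 'a"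
  assumes "compact (UNIV :: 'a set)" "local_homeo T" "finite S"
  shows "finite ((T ^^ n) -` S)"
proof -
  define \<W> where "\<W> = {W. open W \<and> inj_on (T ^^ n) W}"
  have "UNIV \<subseteq> \<Union>\<W>"
    using local_homeo_funpow_locally_inj[OF assms(2)] unfolding \<W>_def by blast
  moreover have "\<forall>W\<in>\<W>. open W" by (simp add: \<W>_def)
  ultimately obtain \<V> where V: "\<V> \<subseteq> \<W>" "finite \<V>" "UNIV \<subseteq> \<Union>\<V>"
    using assms(1) unfolding compact_eq_Heine_Borel by meson
  have "finite ((T ^^ n) -` S \<inter> W)" if "W \<in> \<V>" for W
    using finite_vimage_IntI[OF assms(3)] V(1) that by (auto simp: \<W>_def)
  then have "finite (\<Union>W\<in>\<V>. (T ^^ n) -` S \<inter> W)" using V(2) by blast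
  moreover have "(T ^^ n) -` S \<subseteq> (\<Union>W\<in>\<V>. (T ^^ n) -` S \<inter> W)" using V(3) by blast
  ultimately show ?thesis by (rule rev_finite_subset)
qed

text \<open>When the two orbits first meet, their previous points are distinct preimages of the
  meeting point, which therefore lies in \<open>Sp_l T\<close>.\<close>

lemma funpow_eq_imp_Sp_l:
  assumes "(T ^^ n) a = (T ^^ n) b" "a \<noteq> b"
  obtains i where "i \<le> n" "(T ^^ i) a = (T ^^ i) b" "(T ^^ i) a \<in> Sp_l T"
proof -
  have "\<exists>i\<le>n. (T ^^ i) a = (T ^^ i) b \<and> (T ^^ i) a \<in> Sp_l T"
    using assms(1)
  proof (induction n)
    case 0
    then show ?case using assms(2) by simp
  next
    case (Suc n)
    show ?case
    proof (cases "(T ^^ n) a = (T ^^ n) b")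
      case True
      then show ?thesis using Suc.IH le_SucI by blast
    next
      case False
      then have "(T ^^ Suc n) a \<in> Sp_l T" using Suc.prems by (auto simp: Sp_l_def)
      then show ?thesis using Suc.prems by blast
    qed
  qed
  then show thesis using that by blast
qed

section \<open>Compact pieces of the groupoid\<close>

lemma DR_Z_subset_DR_groupoid: "DR_Z T U m n V \<subseteq> DR_groupoid T"
  unfolding DR_Z_def DR_groupoid_def by blast

lemma openin_DR_Z: "open U \<Longrightarrow> open V \<Longrightarrow> openin (DR_top T) (DR_Z T U m n V)"
  unfolding DR_top_def by (rule topology_generated_by_Basis) blast

lemma topspace_DR_top: "topspace (DR_top T) = DR_groupoid T"
proof -
  have "DR_groupoid T = (\<Union>m n. DR_Z T UNIV m n UNIV)"
    unfolding DR_groupoid_def DR_Z_def by blast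
  moreover have "(\<Union>m n. DR_Z T UNIV m n UNIV) = \<Union>{DR_Z T U m n V | U m n V. open U \<and> open V}"
    unfolding DR_Z_def by (auto; blast)
  ultimately show ?thesis by (simp add: DR_top_def)
qed

text \<open>An arrow of another degree is separated by a basic set, on which the degree is constant.
  For the same degree, disjoint neighbourhoods of \<open>(T ^^ k) x\<close> and
  \<open>(T ^^ l) y\<close> are pulled back to the two endpoints.\<close>

lemma closedin_DR_Z_UNIV:
  fixes T :: "'a::t2_space \<Rightarrow> 'a"
  assumes "continuous_on UNIV T"
  shows "closedin (DR_top T) (DR_Z T UNIV k l UNIV)"
proof -
  have "\<exists>B. openin (DR_top T) B \<and> g \<in> B \<and> B \<subseteq> DR_groupoid T - DR_Z T UNIV k l UNIV"
    if g: "g \<in> DR_groupoid T - DR_Z T UNIV k l UNIV" for g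
  proof -
    obtain x m n y where xy: "g = (x, int m - int n, y)" "(T ^^ m) x = (T ^^ n) y"
      using g by (auto simp: DR_groupoid_def)
    show ?thesis
    proof (cases "int m - int n = int k - int l")
      case False
      then have "DR_Z T UNIV m n UNIV \<subseteq> DR_groupoid T - DR_Z T UNIV k l UNIV"
        using DR_Z_subset_DR_groupoid[of T UNIV m n UNIV] by (auto simp: DR_Z_def)
      moreover have "g \<in> DR_Z T UNIV m n UNIV" using xy by (auto simp: DR_Z_def)
      ultimately show ?thesis using openin_DR_Z[of UNIV UNIV T m n] by blast
    next
      case True
      then have "(T ^^ k) x \<noteq> (T ^^ l) y" using g xy by (auto simp: DR_Z_def)
      then obtain A B where AB: "open A" "open B" "(T ^^ k) x \<in> A" "(T ^^ l) y \<in> B" "A \<inter> B = {}"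
        using hausdorff by metis
      let ?Z = "DR_Z T ((T ^^ k) -` A) m n ((T ^^ l) -` B)"
      have "openin (DR_top T) ?Z"
        using AB assms by (intro openin_DR_Z open_vimage_funpow)
      moreover have "g \<in> ?Z" using AB xy by (auto simp: DR_Z_def)
      moreover have "?Z \<subseteq> DR_groupoid T - DR_Z T UNIV k l UNIV"
        using AB(5) DR_Z_subset_DR_groupoid[of T "(T ^^ k) -` A" m n "(T ^^ l) -` B"]
        by (fastforce simp: DR_Z_def)
      ultimately show ?thesis by blast
    qed
  qed
  then have "openin (DR_top T) (DR_groupoid T - DR_Z T UNIV k l UNIV)"
    by (subst openin_subopen) blast
  then show ?thesis by (simp add: closedin_def topspace_DR_top DR_Z_subset_DR_groupoid)
qed

text \<open>The piece is the image of the compact set \<open>D\<close> of pairs with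
  \<open>T ^^ k\<close> of the first equal to \<open>T ^^ l\<close> of the second, under the map
  inserting the constant degree. The work is the continuity of this map, tested on the generating
  sets.\<close>

lemma compactin_DR_Z_UNIV:
  fixes T :: "'a::t2_space \<Rightarrow> 'a"
  assumes comp: "compact (UNIV :: 'a set)" and T: "local_homeo T"
  shows "compactin (DR_top T) (DR_Z T UNIV k l UNIV)"
proof -
  have cont: "continuous_on UNIV T" using T by (simp add: local_homeo_def)
  define D where "D = {p. (T ^^ k) (fst p) = (T ^^ l) (snd p)}"
  define \<phi> where "\<phi> = (\<lambda>p::'a \<times> 'a. (fst p, int k - int l, snd p))"
  have D: "p \<in> D \<longleftrightarrow> (T ^^ k) (fst p) = (T ^^ l) (snd p)" for p by (simp add: D_def)
  have "continuous_on UNIV (\<lambda>p::'a \<times> 'a. (T ^^ k) (fst p))"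
       "continuous_on UNIV (\<lambda>p::'a \<times> 'a. (T ^^ l) (snd p))"
    by (auto intro!: continuous_on_compose2[OF continuous_on_funpow[OF cont]] continuous_intros)
  then have "closed D" unfolding D_def by (rule closed_Collect_eq)
  moreover have "compact (UNIV :: ('a \<times> 'a) set)"
    using compact_Times[OF comp comp] by simp
  ultimately have "compact D" using compact_Int_closed by fastforce
  then have D_comp: "compactin (top_of_set D) D"
    by (simp add: compactin_subtopology)
  have "openin (top_of_set D) (\<phi> -` DR_Z T U m n V \<inter> D)" if UV: "open U" "open V" for U m n V
  proof -
    have "\<exists>B. openin (top_of_set D) B \<and> p \<in> B \<and> B \<subseteq> \<phi> -` DR_Z T U m n V \<inter> D"
      if p: "p \<in> \<phi> -` DR_Z T U m n V \<inter> D" for p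
    proof -
      obtain x y where xy: "p = (x, y)" by fastforce
      have eq: "int k - int l = int m - int n" "x \<in> U" "y \<in> V" "(T ^^ m) x = (T ^^ n) y"
        using p by (auto simp: DR_Z_def \<phi>_def xy)
      show ?thesis
      \<comment> \<open>Equal degrees make \<open>(m, n)\<close> a common shift of
        \<open>(k, l)\<close>. An upward shift preserves the equation on all of \<open>D\<close>; a
        downward one requires cancelling \<open>T ^^ (k - m)\<close>, which is possible near
        \<open>p\<close> by local injectivity.\<close>
      proof (cases "k \<le> m")
        case True
        then have mn: "m = (m - k) + k" "n = (m - k) + l" using eq(1) by auto
        have "(T ^^ m) a = (T ^^ n) b" if "(T ^^ k) a = (T ^^ l) b" for a b
          using that mn funpow_add_apply by metis
        then have "D \<inter> U \<times> V \<subseteq> \<phi> -` DR_Z T U m n V \<inter> D"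
          using eq(1) by (auto simp: D DR_Z_def \<phi>_def)
        moreover have "openin (top_of_set D) (D \<inter> U \<times> V)"
          using UV by (intro openin_open_Int open_Times)
        ultimately show ?thesis using p eq xy by blast
      next
        case False
        then have kl: "k = (k - m) + m" "l = (k - m) + n" using eq(1) by auto
        obtain W where W: "open W" "(T ^^ m) x \<in> W" "inj_on (T ^^ (k - m)) W"
          using local_homeo_funpow_locally_inj[OF T] by blast
        let ?B = "D \<inter> (U \<inter> (T ^^ m) -` W) \<times> (V \<inter> (T ^^ n) -` W)"
        have "openin (top_of_set D) ?B"
          using UV W(1) cont by (intro openin_open_Int open_Times open_Int open_vimage_funpow)
        moreover have "p \<in> ?B" using p eq xy W by auto
        moreover have "?B \<subseteq> \<phi> -` DR_Z T U m n V \<inter> D"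
        proof
          fix q assume q: "q \<in> ?B"
          obtain a b where ab: "q = (a, b)" by fastforce
          have "(T ^^ k) a = (T ^^ l) b" using q by (simp add: D ab)
          then have "(T ^^ (k - m)) ((T ^^ m) a) = (T ^^ (k - m)) ((T ^^ n) b)"
            using kl funpow_add_apply by metis
          then have "(T ^^ m) a = (T ^^ n) b"
            using W(3) q by (auto simp: ab dest: inj_onD)
          then show "q \<in> \<phi> -` DR_Z T U m n V \<inter> D"
            using q eq(1) by (auto simp: DR_Z_def \<phi>_def ab)
        qed
        ultimately show ?thesis by blast
      qed
    qed
    then show ?thesis by (subst openin_subopen) blast
  qed
  moreover have img: "\<phi> ` D = DR_Z T UNIV k l UNIV"
    by (auto simp: D \<phi>_def DR_Z_def image_iff Bex_def)
  moreover have "DR_Z T UNIV k l UNIV \<subseteq> \<Union>{DR_Z T U m n V | U m n V. open U \<and> open V}"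
    by blast
  ultimately have "continuous_map (top_of_set D) (DR_top T) \<phi>"
    unfolding DR_top_def by (intro continuous_on_generated_topo) auto
  from image_compactin[OF D_comp this] show ?thesis by (simp add: img)
qed

text \<open>The pieces are open and cover the groupoid, so a compact closure needs only finitely
  many. Conversely, a finite union of pieces is closed and compact, hence contains the closure of
  \<open>H\<close> as a closed subset of a compact set.\<close>

lemma rel_compact_in_DR_top_iff:
  fixes T :: "'a::t2_space \<Rightarrow> 'a"
  assumes "compact (UNIV :: 'a set)" "local_homeo T"
  shows "rel_compact_in (DR_top T) H \<longleftrightarrow>
    (\<exists>F. finite F \<and> H \<subseteq> (\<Union>(m, n)\<in>F. DR_Z T UNIV m n UNIV))"
proof
  assume H: "rel_compact_in (DR_top T) H"
  let ?C = "\<lambda>(m, n). DR_Z T UNIV m n UNIV"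
  have "DR_top T closure_of H \<subseteq> DR_groupoid T"
    by (metis closure_of_subset_topspace topspace_DR_top)
  also have "\<dots> \<subseteq> \<Union>(range ?C)"
    by (force simp: DR_groupoid_def DR_Z_def)
  finally have "DR_top T closure_of H \<subseteq> \<Union>(range ?C)" .
  moreover have "openin (DR_top T) U" if "U \<in> range ?C" for U
    using that openin_DR_Z[OF open_UNIV open_UNIV] by auto
  ultimately obtain \<F> where F: "finite \<F>" "\<F> \<subseteq> range ?C" "DR_top T closure_of H \<subseteq> \<Union>\<F>"
    using H unfolding rel_compact_in_def compactin_def by metis
  obtain F where "finite F" "\<F> = ?C ` F"
    using finite_subset_image[OF F(1,2)] by blast
  moreover have "H \<subseteq> DR_top T closure_of H"
    using H by (simp add: closure_of_subset rel_compact_in_def)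
  ultimately show "\<exists>F. finite F \<and> H \<subseteq> \<Union>(?C ` F)" using F(3) by blast
next
  assume "\<exists>F. finite F \<and> H \<subseteq> (\<Union>(m, n)\<in>F. DR_Z T UNIV m n UNIV)"
  then obtain F where F: "finite F" "H \<subseteq> (\<Union>(m, n)\<in>F. DR_Z T UNIV m n UNIV)" (is "_ \<subseteq> ?C")
    by blast
  have cont: "continuous_on UNIV T" using assms(2) by (simp add: local_homeo_def)
  have "closedin (DR_top T) ?C"
    using F(1) closedin_DR_Z_UNIV[OF cont] by (intro closedin_Union) auto
  moreover have "compactin (DR_top T) ?C"
    using F(1) compactin_DR_Z_UNIV[OF assms] by (intro compactin_Union) auto
  moreover have "DR_top T closure_of H \<subseteq> ?C"
    using closure_of_minimal[OF F(2)] calculation by blast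
  ultimately have "compactin (DR_top T) (DR_top T closure_of H)"
    using closed_compactin closedin_closure_of by blast
  moreover have "H \<subseteq> topspace (DR_top T)"
    using F(2) DR_Z_subset_DR_groupoid unfolding topspace_DR_top by fast
  ultimately show "rel_compact_in (DR_top T) H" by (simp add: rel_compact_in_def)
qed

section \<open>Rokhlin towers\<close>

text \<open>Points are related when they reach the same point of the base \<open>U 0\<close>; for a
  Rokhlin tower the degree is then the difference of their unique levels.\<close>

definition tower_groupoid :: "('a \<Rightarrow> 'a) \<Rightarrow> nat \<Rightarrow> (nat \<Rightarrow> 'a set) \<Rightarrow> ('a \<times> int \<times> 'a) set" where
  "tower_groupoid T N U =
    {(x, int k - int l, y) | x k l y. k < N \<and> l < N \<and> x \<in> U k \<and> y \<in> U l \<and> (T ^^ k) x = (T ^^ l) y}"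

lemma rokhlin_tower_level_unique:
  assumes "rokhlin_tower T N U" "k < N" "l < N" "x \<in> U k" "x \<in> U l"
  shows "k = l"
proof (rule ccontr)
  assume "k \<noteq> l"
  then have "closure (U k) \<inter> closure (U l) = {}"
    using assms(1-3) unfolding rokhlin_tower_def by blast
  then show False using assms(4,5) closure_subset by blast
qed

text \<open>Each application of \<open>T\<close> lowers the level by one.\<close>

lemma rokhlin_tower_funpow_iff:
  assumes "rokhlin_tower T N U" "k + m < N"
  shows "(T ^^ m) x \<in> U k \<longleftrightarrow> x \<in> U (k + m)"
  using assms(2)
proof (induction m arbitrary: x)
  case 0
  then show ?case by simp
next
  case (Suc m)
  have "U (k + Suc m) = T -` U (k + m)"
    using assms(1) Suc.prems unfolding rokhlin_tower_def
    by (metis add_Suc_right diff_Suc_1 zero_less_Suc)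
  then show ?case using Suc by (simp add: funpow_swap1)
qed

lemma tower_groupoid_inverse:
  "(x, j, y) \<in> tower_groupoid T N U \<Longrightarrow> (y, - j, x) \<in> tower_groupoid T N U"
  unfolding tower_groupoid_def
  by clarsimp (metis minus_diff_eq)

lemma tower_groupoid_comp:
  assumes "rokhlin_tower T N U"
    and "(x, i, y) \<in> tower_groupoid T N U" "(y, j, z) \<in> tower_groupoid T N U"
  shows "(x, i + j, z) \<in> tower_groupoid T N U"
proof -
  obtain k l where 1: "i = int k - int l" "k < N" "l < N" "x \<in> U k" "y \<in> U l" "(T ^^ k) x = (T ^^ l) y"
    using assms(2) by (auto simp: tower_groupoid_def)
  obtain l' m where 2: "j = int l' - int m" "l' < N" "m < N" "y \<in> U l'" "z \<in> U m"
    "(T ^^ l') y = (T ^^ m) z"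
    using assms(3) by (auto simp: tower_groupoid_def)
  \<comment> \<open>The middle point has only one level, so both arrows compare the same iterate of
    \<open>y\<close>.\<close>
  have "l' = l" using rokhlin_tower_level_unique assms(1) 1 2 by metis
  then have "i + j = int k - int m" "(T ^^ k) x = (T ^^ m) z" using 1 2 by auto
  then show ?thesis using 1 2 unfolding tower_groupoid_def by blast
qed

lemma tower_groupoid_subset:
  "tower_groupoid T N U \<subseteq> (\<Union>(m, n)\<in>{..<N} \<times> {..<N}. DR_Z T UNIV m n UNIV)"
  unfolding tower_groupoid_def DR_Z_def by auto

section \<open>Absence of periodic points and trivial isotropy\<close>

lemma rok_dim_le_no_periodic:
  assumes "rok_dim_le T d" "0 < p"
  shows "(T ^^ p) x \<noteq> x"
proof
  assume x: "(T ^^ p) x = x"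
  \<comment> \<open>With height \<open>2 * p\<close>, every level has another one exactly
    \<open>p\<close> above or \<open>p\<close> below it; a point of period \<open>p\<close> would
    lie on both.\<close>
  have "2 * p \<ge> 1" using assms(2) by simp
  then obtain \<T> where \<T>: "\<forall>U\<in>\<T>. rokhlin_tower T (2 * p) U"
      "UNIV \<subseteq> (\<Union>U\<in>\<T>. \<Union>k<2*p. U k)"
    using assms(1) unfolding rok_dim_le_def by meson
  have "x \<in> (\<Union>U\<in>\<T>. \<Union>k<2*p. U k)" using \<T>(2) by (rule subsetD) simp
  then obtain U k where "U \<in> \<T>" "k < 2 * p" "x \<in> U k" by (elim UN_E) simp
  then have U: "rokhlin_tower T (2 * p) U" "k < 2 * p" "x \<in> U k" using \<T>(1) by simp_all
  show False
  proof (cases "k < p")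
    case True
    then have "x \<in> U (k + p)" using rokhlin_tower_funpow_iff[OF U(1), of k p x] U x by simp
    then show ?thesis using rokhlin_tower_level_unique[OF U(1), of k "k + p" x] U True assms(2) by simp
  next
    case False
    then have "x \<in> U (k - p)" using rokhlin_tower_funpow_iff[OF U(1), of "k - p" p x] U x by simp
    then have "k = k - p"
      using rokhlin_tower_level_unique[OF U(1), of k "k - p" x] U by simp
    then show ?thesis using False assms(2) by simp
  qed
qed

lemma funpow_eq_imp_eq:
  assumes "\<And>p x. 0 < p \<Longrightarrow> (T ^^ p) x \<noteq> x" "(T ^^ m) x = (T ^^ n) x"
  shows "m = n"
proof -
  have "\<not> m < n" if "(T ^^ m) x = (T ^^ n) x" for m n
  proof
    assume "m < n"
    then have "(T ^^ (n - m)) ((T ^^ m) x) = (T ^^ m) x"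
      using that funpow_add_apply[of "n - m" m T x] by simp
    then show False using assms(1)[of "n - m"] \<open>m < n\<close> by simp
  qed
  then show ?thesis using assms(2) by (metis nat_neq_iff)
qed

lemma DR_groupoid_inverse: "(x, k, y) \<in> DR_groupoid T \<Longrightarrow> (y, - k, x) \<in> DR_groupoid T"
  unfolding DR_groupoid_def
  by clarsimp (metis minus_diff_eq)

lemma DR_groupoid_comp:
  assumes "(x, i, y) \<in> DR_groupoid T" "(y, j, z) \<in> DR_groupoid T"
  shows "(x, i + j, z) \<in> DR_groupoid T"
proof -
  obtain m n where 1: "i = int m - int n" "(T ^^ m) x = (T ^^ n) y"
    using assms(1) by (auto simp: DR_groupoid_def)
  obtain p q where 2: "j = int p - int q" "(T ^^ p) y = (T ^^ q) z"
    using assms(2) by (auto simp: DR_groupoid_def)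
  have "(T ^^ (p + m)) x = (T ^^ (n + q)) z"
    using 1(2) 2(2) by (metis add.commute funpow_add_apply)
  moreover have "i + j = int (p + m) - int (n + q)" using 1 2 by simp
  ultimately show ?thesis unfolding DR_groupoid_def by blast
qed

text \<open>Two arrows with the same endpoints differ by an isotropy arrow, whose degree vanishes
  without periodic points. An arrow is thus determined by its endpoints.\<close>

lemma DR_groupoid_finite_restriction:
  assumes "\<And>p x. 0 < p \<Longrightarrow> (T ^^ p) x \<noteq> x" "finite P"
  shows "finite {g \<in> DR_groupoid T. DR_r g \<in> P \<and> DR_s g \<in> P}"
proof (rule inj_on_finite)
  let ?G = "{g \<in> DR_groupoid T. DR_r g \<in> P \<and> DR_s g \<in> P}"
  have "i = j" if "(x, i, y) \<in> DR_groupoid T" "(x, j, y) \<in> DR_groupoid T" for x i j y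
  proof -
    have "(x, i + - j, x) \<in> DR_groupoid T"
      using DR_groupoid_comp DR_groupoid_inverse that by metis
    then obtain m n where mn: "i + - j = int m - int n" "(T ^^ m) x = (T ^^ n) x"
      by (auto simp: DR_groupoid_def)
    then have "m = n" using funpow_eq_imp_eq[of T m x n] assms(1) by blast
    then show ?thesis using mn by simp
  qed
  then show "inj_on (\<lambda>g. (DR_r g, DR_s g)) ?G"
    by (auto simp: inj_on_def DR_r_def DR_s_def)
  show "(\<lambda>g. (DR_r g, DR_s g)) ` ?G \<subseteq> P \<times> P" by auto
  show "finite (P \<times> P)" using assms(2) by simp
qed

section \<open>Arrows with bounded exponents inside half a tower\<close>

text \<open>The common image still lies in the tower, on level \<open>k - m\<close> and on level
  \<open>l - n\<close>. These agree, and the remaining \<open>k - m\<close> steps carry it to the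
  base.\<close>

lemma tower_groupoid_upper:
  assumes U: "rokhlin_tower T N U"
    and k: "M \<le> k" "k < N" "x \<in> U k" and l: "M \<le> l" "l < N" "y \<in> U l"
    and mn: "m \<le> M" "n \<le> M" "(T ^^ m) x = (T ^^ n) y"
  shows "(x, int m - int n, y) \<in> tower_groupoid T N U"
proof -
  have "(T ^^ m) x \<in> U (k - m)" "(T ^^ n) y \<in> U (l - n)"
    using rokhlin_tower_funpow_iff[OF U, of "k - m" m x]
      rokhlin_tower_funpow_iff[OF U, of "l - n" n y] k l mn by auto
  then have eq: "k - m = l - n"
    using rokhlin_tower_level_unique[OF U, of "k - m" "l - n"] k l mn(3) by auto
  have "k = (k - m) + m" "l = (k - m) + n" using eq k l mn by auto
  then have "(T ^^ k) x = (T ^^ l) y" using mn(3) funpow_add_apply by metis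
  moreover have "int m - int n = int k - int l" using eq k l mn by linarith
  ultimately show ?thesis using k l unfolding tower_groupoid_def by blast
qed

lemma tower_groupoid_lower_aux:
  assumes U: "rokhlin_tower T (2 * M) U"
    and k: "k < M" "x \<in> U k" and l: "l < M" "y \<in> U l"
    and mn: "n \<le> m" "m \<le> M" "(T ^^ m) x = (T ^^ n) y"
  shows "(x, int m - int n, y) \<in> tower_groupoid T (2 * M) U \<or>
    (\<exists>i\<le>M. (T ^^ i) x \<in> Sp_l T) \<and> (\<exists>i\<le>M. (T ^^ i) y \<in> Sp_l T)"
proof (cases "(T ^^ (m - n)) x = y")
  case True
  \<comment> \<open>Here the height \<open>2 * M\<close> matters: \<open>l < M\<close> and
    \<open>m - n \<le> M\<close> keep this level inside the tower.\<close>
  have "x \<in> U (l + (m - n))"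
    using rokhlin_tower_funpow_iff[OF U, of l "m - n" x] True k l mn by simp
  then have eq: "k = l + (m - n)"
    using rokhlin_tower_level_unique[OF U, of k "l + (m - n)" x] k l mn by simp
  then have "(T ^^ k) x = (T ^^ l) y" using True by (simp add: funpow_add)
  moreover have "int m - int n = int k - int l" using eq mn by simp
  moreover have "k < 2 * M" "l < 2 * M" using k l by auto
  ultimately show ?thesis using k l unfolding tower_groupoid_def by blast
next
  case False
  have "m = n + (m - n)" using mn by simp
  \<comment> \<open>Distinct points with equal \<open>n\<close>-th iterates merge at a point of
    \<open>Sp_l T\<close>, reached from both \<open>x\<close> and \<open>y\<close> in at most
    \<open>M\<close> steps.\<close>
  then have "(T ^^ n) ((T ^^ (m - n)) x) = (T ^^ n) y"
    using mn(3) funpow_add_apply by metis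
  then obtain i where i: "i \<le> n" "(T ^^ i) ((T ^^ (m - n)) x) = (T ^^ i) y"
      "(T ^^ i) ((T ^^ (m - n)) x) \<in> Sp_l T"
    using False by (rule funpow_eq_imp_Sp_l)
  have "(T ^^ (i + (m - n))) x \<in> Sp_l T" using i(3) by (simp add: funpow_add)
  moreover have "i + (m - n) \<le> M" "i \<le> M" using i(1) mn by auto
  moreover have "(T ^^ i) y \<in> Sp_l T" using i by simp
  ultimately show ?thesis by blast
qed

lemma tower_groupoid_lower:
  assumes U: "rokhlin_tower T (2 * M) U"
    and k: "k < M" "x \<in> U k" and l: "l < M" "y \<in> U l"
    and mn: "m \<le> M" "n \<le> M" "(T ^^ m) x = (T ^^ n) y"
  shows "(x, int m - int n, y) \<in> tower_groupoid T (2 * M) U \<or>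
    (\<exists>i\<le>M. (T ^^ i) x \<in> Sp_l T) \<and> (\<exists>i\<le>M. (T ^^ i) y \<in> Sp_l T)"
proof (cases "n \<le> m")
  case True
  then show ?thesis using tower_groupoid_lower_aux[OF U k l] mn by blast
next
  case False
  then show ?thesis
    using tower_groupoid_lower_aux[OF U l k, of m n] mn
      tower_groupoid_inverse[of y "int n - int m" x T "2 * M" U] by auto
qed

section \<open>Enlarging a tower groupoid by finitely many arrows\<close>

text \<open>The union of the tower groupoid with all arrows over \<open>P\<close> need not be closed
  under composition. Replacing \<open>P\<close> by its saturation \<open>Q\<close> repairs this, and
  \<open>Q\<close> stays finite because iterates of \<open>T\<close> have finite fibres.\<close>

lemma tower_groupoid_Un_finite:
  fixes T :: "'a::t2_space \<Rightarrow> 'a"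
  assumes comp: "compact (UNIV :: 'a set)" and T: "local_homeo T"
    and np: "\<And>p x. 0 < p \<Longrightarrow> (T ^^ p) x \<noteq> x"
    and U: "rokhlin_tower T N U" and P: "finite P"
  obtains H where "DR_subgroupoid T H" "rel_compact_in (DR_top T) H"
    "tower_groupoid T N U \<subseteq> H" "{g \<in> DR_groupoid T. DR_r g \<in> P \<and> DR_s g \<in> P} \<subseteq> H"
proof
  let ?E = "tower_groupoid T N U"
  define Q where "Q = P \<union> {x. \<exists>j. \<exists>p\<in>P. (x, j, p) \<in> ?E}"
  define G where "G = {g \<in> DR_groupoid T. DR_r g \<in> Q \<and> DR_s g \<in> Q}"
  have G: "(x, j, y) \<in> G \<longleftrightarrow> (x, j, y) \<in> DR_groupoid T \<and> x \<in> Q \<and> y \<in> Q" for x j y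
    by (simp add: G_def DR_r_def DR_s_def)
  have "finite (\<Union>k<N. \<Union>l<N. (T ^^ k) -` ((T ^^ l) ` P))"
    using P local_homeo_finite_vimage_funpow[OF comp T] by blast
  moreover have "{x. \<exists>j. \<exists>p\<in>P. (x, j, p) \<in> ?E} \<subseteq> (\<Union>k<N. \<Union>l<N. (T ^^ k) -` ((T ^^ l) ` P))"
    by (auto simp: tower_groupoid_def)
  ultimately have "finite Q" unfolding Q_def using P finite_subset by blast
  then have "finite G" unfolding G_def by (intro DR_groupoid_finite_restriction np)
  have sat: "x \<in> Q" if "(x, j, y) \<in> ?E" "y \<in> Q" for x j y
    using that tower_groupoid_comp[OF U] unfolding Q_def by blast
  have sat': "y \<in> Q" if "(x, j, y) \<in> ?E" "x \<in> Q" for x j y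
    using sat tower_groupoid_inverse that by metis
  have E: "?E \<subseteq> DR_groupoid T"
    using tower_groupoid_subset[of T N U] DR_Z_subset_DR_groupoid by fastforce
  show "DR_subgroupoid T (?E \<union> G)"
    unfolding DR_subgroupoid_def
  proof (intro conjI allI impI)
    show "?E \<union> G \<subseteq> DR_groupoid T" using E by (auto simp: G_def)
  next
    fix x j y assume "(x, j, y) \<in> ?E \<union> G"
    then show "(y, - j, x) \<in> ?E \<union> G"
      using tower_groupoid_inverse[of x j y] DR_groupoid_inverse[of x j y] G by auto
  next
    fix x i y j z assume *: "(x, i, y) \<in> ?E \<union> G \<and> (y, j, z) \<in> ?E \<union> G"
    then have in_G: "(x, i + j, z) \<in> DR_groupoid T"
      using E DR_groupoid_comp[of x i y T j z] unfolding G_def by blast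
    show "(x, i + j, z) \<in> ?E \<union> G"
    \<comment> \<open>If \<open>y\<close> is in the saturated set \<open>Q\<close>, so are
      \<open>x\<close> and \<open>z\<close>, and the composite lies in \<open>G\<close>. Otherwise
      neither factor lies in \<open>G\<close> and both are tower arrows.\<close>
    proof (cases "y \<in> Q")
      case True
      then show ?thesis using * in_G sat sat' G by blast
    next
      case False
      then show ?thesis using * tower_groupoid_comp[OF U] G by blast
    qed
  qed
  \<comment> \<open>One piece for each of the finitely many arrows of \<open>G\<close> suffices for
    relative compactness.\<close>
  have "\<exists>mn. g \<in> DR_Z T UNIV (fst mn) (snd mn) UNIV" if "g \<in> G" for g
    using that by (fastforce simp: G_def DR_groupoid_def DR_Z_def)
  then obtain f where f: "\<And>g. g \<in> G \<Longrightarrow> g \<in> DR_Z T UNIV (fst (f g)) (snd (f g)) UNIV"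
    by metis
  have "?E \<union> G \<subseteq> (\<Union>(m, n)\<in>{..<N} \<times> {..<N} \<union> f ` G. DR_Z T UNIV m n UNIV)"
    using tower_groupoid_subset[of T N U] f by (fastforce simp: case_prod_beta)
  moreover have "finite ({..<N} \<times> {..<N} \<union> f ` G)" using \<open>finite G\<close> by simp
  ultimately show "rel_compact_in (DR_top T) (?E \<union> G)"
    using rel_compact_in_DR_top_iff[OF comp T] by blast
  show "?E \<subseteq> ?E \<union> G" by simp
  show "{g \<in> DR_groupoid T. DR_r g \<in> P \<and> DR_s g \<in> P} \<subseteq> ?E \<union> G"
    by (auto simp: G_def Q_def)
qed

section \<open>The cover by half towers\<close>

text \<open>\<open>DR_dad_le\<close> wants a family indexed by all of \<open>{..d}\<close>, so an
  enumeration of a possibly smaller set is padded by repeating its last member.\<close>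

lemma finite_card_le_image_atMost:
  assumes "finite S" "S \<noteq> {}" "card S \<le> Suc n"
  obtains f where "f ` {..n} = S"
proof -
  obtain g where g: "bij_betw g {0..<card S} S" using assms(1) ex_bij_betw_nat_finite by blast
  have pos: "card S > 0" using assms(1,2) by (simp add: card_gt_0_iff)
  have "(\<lambda>i. min i (card S - 1)) ` {..n} = {0..<card S}"
  proof
    show "{0..<card S} \<subseteq> (\<lambda>i. min i (card S - 1)) ` {..n}"
    proof
      fix i assume "i \<in> {0..<card S}"
      then show "i \<in> (\<lambda>i. min i (card S - 1)) ` {..n}"
        using assms(3) by (intro image_eqI[of _ _ i]) auto
    qed
  qed (use pos in auto)
  then have "(\<lambda>i. g (min i (card S - 1))) ` {..n} = S"
    using g unfolding bij_betw_def by (metis image_image)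
  then show thesis using that by blast
qed

lemma rok_dim_le_imp_DR_dad_le:
  fixes T :: "'a::t2_space \<Rightarrow> 'a"
  assumes comp: "compact (UNIV :: 'a set)" and T: "local_homeo T"
    and fin: "finite (Sp_l T)" and d: "rok_dim_le T d"
  shows "DR_dad_le T (2 * d + 1)"
  unfolding DR_dad_le_def
proof (intro allI impI)
  fix K assume K: "openin (DR_top T) K \<and> rel_compact_in (DR_top T) K"
  obtain F where F: "finite F" "K \<subseteq> (\<Union>(m, n)\<in>F. DR_Z T UNIV m n UNIV)"
    using K rel_compact_in_DR_top_iff[OF comp T] by blast
  have "finite (fst ` F \<union> snd ` F)" using F(1) by simp
  then obtain M' where M': "\<forall>i\<in>fst ` F \<union> snd ` F. i \<le> M'"
    using finite_nat_set_iff_bounded_le by meson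
  \<comment> \<open>The successor makes \<open>2 * M\<close> a legitimate tower height even if all
    exponents are zero.\<close>
  define M where "M = Suc M'"
  have KM: "\<exists>m n. m \<le> M \<and> n \<le> M \<and> j = int m - int n \<and> (T ^^ m) x = (T ^^ n) y"
    if K_mem: "(x, j, y) \<in> K" for x j y
  proof -
    obtain m n where mn: "(m, n) \<in> F" "(x, j, y) \<in> DR_Z T UNIV m n UNIV"
      using F(2) K_mem by blast
    then have "m \<le> M'" "n \<le> M'" using M' by force+
    then have "m \<le> M" "n \<le> M" by (simp_all add: M_def)
    moreover have "j = int m - int n" "(T ^^ m) x = (T ^^ n) y"
      using mn(2) by (auto simp: DR_Z_def)
    ultimately show ?thesis by blast
  qed
  have "2 * M \<ge> 1" by (simp add: M_def)
  then obtain \<T> where \<T>: "finite \<T>" "card \<T> \<le> d + 1" "\<And>U. U \<in> \<T> \<Longrightarrow> rokhlin_tower T (2 * M) U"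
      "UNIV \<subseteq> (\<Union>U\<in>\<T>. \<Union>k<2*M. U k)"
    using d unfolding rok_dim_le_def by meson
  have np: "(T ^^ p) x \<noteq> x" if "0 < p" for p x
    using rok_dim_le_no_periodic[OF d that] .
  \<comment> \<open>\<open>P\<close> contains both endpoints of every arrow of \<open>K\<close> that
    joins points of one lower half without belonging to the tower groupoid. It depends on
    \<open>M\<close> but not on the tower.\<close>
  define P where "P = (\<Union>i\<le>M. (T ^^ i) -` Sp_l T)"
  have "finite P" unfolding P_def using local_homeo_finite_vimage_funpow[OF comp T fin] by blast
  define lower where "lower U = (\<Union>k<M. U k)" for U :: "nat \<Rightarrow> 'a set"
  define upper where "upper U = (\<Union>k\<in>{M..<2*M}. U k)" for U :: "nat \<Rightarrow> 'a set"
  define S where "S = lower ` \<T> \<union> upper ` \<T>"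
  \<comment> \<open>Half towers may coincide, so only an upper bound is claimed:
    \<open>2 * (d + 1)\<close>, the number of indices up to \<open>2 * d + 1\<close>.\<close>
  have "card S \<le> card (lower ` \<T>) + card (upper ` \<T>)"
    unfolding S_def by (rule card_Un_le)
  also have "\<dots> \<le> card \<T> + card \<T>"
    using \<T>(1) by (intro add_mono card_image_le)
  finally have "card S \<le> Suc (2 * d + 1)" using \<T>(2) by simp
  moreover have "finite S" "S \<noteq> {}" using \<T>(1,4) by (auto simp: S_def)
  ultimately obtain V where V: "V ` {..2 * d + 1} = S"
    using finite_card_le_image_atMost by metis
  have V_in: "\<exists>U\<in>\<T>. V i = lower U \<or> V i = upper U" if "i \<le> 2 * d + 1" for i
    using V that unfolding S_def by blast
  show "\<exists>U. (\<forall>i\<le>2 * d + 1. open (U i)) \<and> DR_s ` K \<union> DR_r ` K \<subseteq> (\<Union>i\<le>2 * d + 1. U i) \<and>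
      (\<forall>i\<le>2 * d + 1. \<exists>H. DR_subgroupoid T H \<and> rel_compact_in (DR_top T) H \<and>
        {g \<in> K. DR_s g \<in> U i \<and> DR_r g \<in> U i} \<subseteq> H)"
  proof (intro exI[of _ V] conjI allI impI)
    fix i assume "i \<le> 2 * d + 1"
    then obtain U where U: "U \<in> \<T>" "V i = lower U \<or> V i = upper U" using V_in by blast
    have "open (U k)" if "k < 2 * M" for k
      using \<T>(3)[OF U(1)] that unfolding rokhlin_tower_def by blast
    then show "open (V i)" using U(2) by (auto simp: lower_def upper_def intro!: open_Union)
  next
    have "x \<in> \<Union>S" for x
    proof -
      obtain U k where "U \<in> \<T>" "k < 2 * M" "x \<in> U k" using \<T>(4) by blast
      then show ?thesis
        by (cases "k < M") (auto simp: S_def lower_def upper_def)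
    qed
    then show "DR_s ` K \<union> DR_r ` K \<subseteq> (\<Union>i\<le>2 * d + 1. V i)" using V by auto
  next
    fix i assume "i \<le> 2 * d + 1"
    then obtain U where U: "U \<in> \<T>" "V i = lower U \<or> V i = upper U" using V_in by blast
    note tower = \<T>(3)[OF U(1)]
    obtain H where H: "DR_subgroupoid T H" "rel_compact_in (DR_top T) H"
        "tower_groupoid T (2 * M) U \<subseteq> H" "{g \<in> DR_groupoid T. DR_r g \<in> P \<and> DR_s g \<in> P} \<subseteq> H"
      using tower_groupoid_Un_finite[OF comp T np tower \<open>finite P\<close>] by blast
    have "g \<in> H" if g: "g \<in> K" "DR_s g \<in> V i" "DR_r g \<in> V i" for g
    proof -
      obtain x j y where xy: "g = (x, j, y)" using prod_cases3 by blast
      obtain m n where mn: "m \<le> M" "n \<le> M" "j = int m - int n" "(T ^^ m) x = (T ^^ n) y"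
        using KM g(1) xy by blast
      have x: "x \<in> V i" and y: "y \<in> V i" using g xy by (auto simp: DR_r_def DR_s_def)
      from U(2) show ?thesis
      proof
        assume Vi: "V i = lower U"
        obtain k l where kl: "k < M" "x \<in> U k" "l < M" "y \<in> U l"
          using x y unfolding Vi lower_def by blast
        have "g \<in> tower_groupoid T (2 * M) U \<or> x \<in> P \<and> y \<in> P"
          using tower_groupoid_lower[OF tower kl mn(1,2,4)] mn(3) xy unfolding P_def by blast
        moreover have "g \<in> DR_groupoid T" using mn xy by (auto simp: DR_groupoid_def)
        ultimately show ?thesis using H(3,4) xy by (auto simp: DR_r_def DR_s_def)
      next
        assume Vi: "V i = upper U"
        obtain k l where "M \<le> k" "k < 2 * M" "x \<in> U k" "M \<le> l" "l < 2 * M" "y \<in> U l"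
          using x y unfolding Vi upper_def by auto
        then show ?thesis
          using tower_groupoid_upper[OF tower _ _ _ _ _ _ mn(1,2,4)] mn(3) xy H(3) by blast
      qed
    qed
    then show "\<exists>H. DR_subgroupoid T H \<and> rel_compact_in (DR_top T) H \<and>
        {g \<in> K. DR_s g \<in> V i \<and> DR_r g \<in> V i} \<subseteq> H"
      using H(1,2) by blast
  qed
qed

theorem theorem5p12:
  fixes T :: "'a::metric_space \<Rightarrow> 'a"
  assumes "compact (UNIV :: 'a set)"
    and "surj T"
    and "local_homeo T"
    and "finite (Sp_l T)"
    and "\<forall>x\<in>Sp_l T. open {x}"
  shows "DR_dad T \<le> 2 * rok_dim T + 1"
proof (cases "{d. rok_dim_le T d} = {}")
  case True
  then have "rok_dim T = \<infinity>" by (simp add: rok_dim_def top_enat_def)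
  then show ?thesis by (simp add: numeral_eq_enat)
next
  case False
  \<comment> \<open>Since \<open>enat\<close> is well-ordered, the infimum of a nonempty set is
    attained, which gives an actual natural number \<open>d\<close> with
    \<open>rok_dim_le T d\<close>.\<close>
  then obtain d\<^sub>0 where "enat d\<^sub>0 \<in> enat ` {d. rok_dim_le T d}" by blast
  then have "rok_dim T \<in> enat ` {d. rok_dim_le T d}"
    unfolding rok_dim_def by (rule wellorder_InfI)
  then obtain d where d: "rok_dim_le T d" "rok_dim T = enat d" by blast
  have "DR_dad_le T (2 * d + 1)"
    using rok_dim_le_imp_DR_dad_le assms(1,3,4) d(1) by blast
  then have "DR_dad T \<le> enat (2 * d + 1)"
    unfolding DR_dad_def by (intro INF_lower) simp
  then show ?thesis by (simp add: d(2) numeral_eq_enat one_enat_def)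
qed

end
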